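(* Let $\emptyset\neq L\subseteq M\subset N\subseteq V$, and suppose that the table $\mathfrak{X}_{N}$ is collapsible over $N\setminus M$ into the table $\mathfrak{X}_{M}$ with respect to $\lambda_{L}^{N}$. Then it is strictly collapsible (over $N\setminus M$ into $\mathfrak{X}_M$ with respect to $\lambda_L^N$) if and only if, for all $x_N\in\mathfrak{X}_N$, $$\sum_{Z\subseteq L}(-1)^{|L\setminus Z|}\,\nu_{Z\cup(N\setminus L)}^{N}(x_{Z},x_{N\setminus L})=\sum_{Z\subseteq L}(-1)^{|L\setminus Z|}\,\nu_{Z\cup(M\setminus L)}^{N}(x_{Z},x_{M\setminus L}).$$
   Context: $V$ is a finite index set; for $v\in V$, $X_v$ is a categorical variable with finite level set $\mathfrak{X}_v=\{0,1,\dots,|\mathfrak{X}_v|-1\}$. For $A\subseteq V$, $\mathfrak{X}_A=\prod_{v\in A}\mathfrak{X}_v$ (with $|\mathfrak{X}_\emptyset|=1$); for $x\in\mathfrak{X}_A$ and $B\subseteq A$, $x_B$ is the restriction of $x$ to $B$. The joint distribution $p=p_V$ of $(X_v)_{v\in V}$ on $\mathfrak{X}_V$ is strictly positive, and $p_A$ denotes its marginal on $\mathfrak{X}_A$. The symbol $\subset$ denotes strict inclusion. For $L\subseteq M\subseteq V$ and $x_L\in\mathfrak{X}_L$, define $$\nu_L^M(x_L)=\frac{1}{|\mathfrak{X}_{M\setminus L}|}\sum_{j_M\in\mathfrak{X}_M:\,j_L=x_L}\log p_M(j_M),\qquad \lambda_L^M(x_L)=\sum_{L'\subseteq L}(-1)^{|L\setminus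 L'|}\nu_{L'}^M(x_{L'}).$$ $\lambda_L^M$ is called a marginal log-linear (MLL) parameter. For $\emptyset\ne L\subseteq M\subset N\subseteq V$, the table $\mathfrak{X}_N$ is collapsible over $N\setminus M$ into $\mathfrak{X}_M$ with respect to $\lambda_L^N$ if $\lambda_L^M(x_L)=\lambda_L^N(x_L)$ for all $x_L\in\mathfrak{X}_L$. It is strictly collapsible over $N\setminus M$ into $\mathfrak{X}_M$ with respect to $\lambda_L^N$ if it is collapsible in this sense and in addition $\lambda_Z^N(x_Z)=0$ for all $x_Z\in\mathfrak{X}_Z$ and all $Z\subseteq N$ with $L\subset Z\not\subseteq M$. *)

theory Defs
  imports "HOL-Probability.Probability_Mass_Function" "HOL-Library.FuncSet"
begin

text \<open>
  The variables are indexed by a set of elements of type \<open>'v\<close>; \<open>d v\<close> is the number of levels of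
  the variable \<open>v\<close>, so its level set is \<open>{0, ..., d v - 1}\<close>. A cell of the table over \<open>A\<close> is an
  extensional function on \<open>A\<close>, so that \<open>x\<^sub>B\<close> is \<open>restrict x B\<close> and the table over \<open>{}\<close> has exactly
  one cell.
\<close>

definition cells :: "('v \<Rightarrow> nat) \<Rightarrow> 'v set \<Rightarrow> ('v \<Rightarrow> nat) set" where
  "cells d A = PiE A (\<lambda>v. {..<d v})"

definition marginal :: "('v \<Rightarrow> nat) pmf \<Rightarrow> 'v set \<Rightarrow> ('v \<Rightarrow> nat) pmf" where
  "marginal p A = map_pmf (\<lambda>x. restrict x A) p"

text \<open>In the following, \<open>nu d p M L\<close> is \<open>\<nu>\<close> with superscript \<open>M\<close> and subscript \<open>L\<close>; likewise
  \<open>mll d p M L\<close> is the marginal log-linear parameter \<open>\<lambda>\<close> with superscript \<open>M\<close> and subscript \<open>L\<close>.\<close>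

definition nu :: "('v \<Rightarrow> nat) \<Rightarrow> ('v \<Rightarrow> nat) pmf \<Rightarrow> 'v set \<Rightarrow> 'v set \<Rightarrow> ('v \<Rightarrow> nat) \<Rightarrow> real" where
  "nu d p M L x =
     (1 / real (card (cells d (M - L)))) *
     (\<Sum>j\<in>{j \<in> cells d M. restrict j L = x}. ln (pmf (marginal p M) j))"

definition mll :: "('v \<Rightarrow> nat) \<Rightarrow> ('v \<Rightarrow> nat) pmf \<Rightarrow> 'v set \<Rightarrow> 'v set \<Rightarrow> ('v \<Rightarrow> nat) \<Rightarrow> real" where
  "mll d p M L x = (\<Sum>L'\<in>Pow L. (- 1) ^ card (L - L') * nu d p M L' (restrict x L'))"

text \<open>\<open>collapsible d p N M L\<close>: the table over \<open>N\<close> is collapsible over \<open>N - M\<close> into the table over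
  \<open>M\<close> with respect to \<open>mll d p N L\<close>. The notion is used for \<open>{} \<noteq> L \<subseteq> M \<subset> N\<close> only.\<close>

definition collapsible ::
  "('v \<Rightarrow> nat) \<Rightarrow> ('v \<Rightarrow> nat) pmf \<Rightarrow> 'v set \<Rightarrow> 'v set \<Rightarrow> 'v set \<Rightarrow> bool" where
  "collapsible d p N M L \<longleftrightarrow> (\<forall>x\<in>cells d L. mll d p M L x = mll d p N L x)"

definition strictly_collapsible ::
  "('v \<Rightarrow> nat) \<Rightarrow> ('v \<Rightarrow> nat) pmf \<Rightarrow> 'v set \<Rightarrow> 'v set \<Rightarrow> 'v set \<Rightarrow> bool" where
  "strictly_collapsible d p N M L \<longleftrightarrow>
     collapsible d p N M L \<and>
     (\<forall>Z. Z \<subseteq> N \<and> L \<subset> Z \<and> \<not> Z \<subseteq> M \<longrightarrow> (\<forall>x\<in>cells d Z. mll d p N Z x = 0))"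

end

theory Submission imports Defs begin

text \<open>
  Write \<open>\<lambda>\<^sub>Z\<close> for \<open>mll d p N Z\<close>. It is the Moebius transform, over the lattice of subsets, of
  \<open>Z \<mapsto> \<nu>\<^sub>Z\<close>. Moebius inversion with respect to the part of the index set that lies outside \<open>L\<close>
  (\<open>sum_moebius_disjoint_union\<close>) turns the alternating sum
  \<open>\<Sum>\<^bsub>Z \<subseteq> L\<^esub> (-1)\<^bsup>|L - Z|\<^esup> \<nu>\<^bsub>Z \<union> C\<^esub>\<close> with \<open>C\<close> disjoint from \<open>L\<close> into \<open>\<Sum>\<^bsub>D \<subseteq> C\<^esub> \<lambda>\<^bsub>L \<union> D\<^esub>\<close>. The two
  sides of the equation to be characterised are the cases \<open>C = N - L\<close> and \<open>C = M - L\<close>, so their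
  difference is the sum of all \<open>\<lambda>\<^sub>Z(x\<^sub>Z)\<close> with \<open>L \<subset> Z \<subseteq> N\<close> and \<open>Z\<close> not contained in \<open>M\<close>. These
  are exactly the interactions that strict collapsibility requires to vanish.

  It remains to see that a sum of interactions vanishes identically only if each of them does. This
  is the uniqueness of the ANOVA decomposition: \<open>\<lambda>\<^sub>Z\<close> depends on the coordinates in \<open>Z\<close> only, and
  its sum over the levels of any one coordinate in \<open>Z\<close> is zero (\<open>sum_levels_mll\<close>), because summing
  \<open>\<nu>\<close> over the levels of a coordinate amounts to dropping that coordinate (\<open>sum_levels_nu\<close>).
  Functions \<open>g\<^sub>Z\<close> with these two properties can add up to zero only if each of them is zero
  (\<open>interactions_vanish\<close>).
\<close>

section \<open>Moebius transform of set functions\<close>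

definition subset_moebius :: "('a set \<Rightarrow> real) \<Rightarrow> 'a set \<Rightarrow> real" where
  "subset_moebius f A = (\<Sum>B\<in>Pow A. (- 1) ^ card (A - B) * f B)"

lemma sum_Pow_insert:
  fixes F :: "'a set \<Rightarrow> real"
  assumes "finite A" "a \<notin> A"
  shows "sum F (Pow (insert a A)) = (\<Sum>B\<in>Pow A. F B) + (\<Sum>B\<in>Pow A. F (insert a B))"
proof -
  have "inj_on (insert a) (Pow A)"
    using assms(2) by (intro inj_onI) (metis PowD insert_ident subsetD)
  moreover have "Pow A \<inter> insert a ` Pow A = {}"
    using assms(2) by auto
  ultimately show ?thesis
    using assms(1) by (simp add: Pow_insert sum.union_disjoint sum.reindex)
qed

lemma moebius_insert:
  assumes "finite A" "a \<notin> A"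
  shows "subset_moebius f (insert a A) = subset_moebius (\<lambda>B. f (insert a B)) A - subset_moebius f A"
proof -
  have "card (insert a A - B) = Suc (card (A - B))" if "B \<subseteq> A" for B
  proof -
    have "insert a A - B = insert a (A - B)"
      using that assms(2) by auto
    then show ?thesis
      using assms by simp
  qed
  moreover have "insert a A - insert a B = A - B" for B
    using assms(2) by auto
  ultimately show ?thesis
    unfolding subset_moebius_def sum_Pow_insert[OF assms] by (simp add: sum_negf)
qed

text \<open>
  For \<open>L = {}\<close> this is Moebius inversion; in general it is Moebius inversion with respect to the
  elements of \<open>C\<close>, with those of \<open>L\<close> left transformed. The induction step works because adding an
  element \<open>c\<close> to \<open>C\<close> pairs \<open>L \<union> D\<close> with \<open>insert c (L \<union> D)\<close>, and the two transforms add up to that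
  of \<open>B \<mapsto> f (insert c B)\<close> at \<open>L \<union> D\<close>.
\<close>

lemma sum_moebius_disjoint_union:
  assumes "finite C" "finite L" "L \<inter> C = {}"
  shows "(\<Sum>D\<in>Pow C. subset_moebius f (L \<union> D)) = (\<Sum>Z\<in>Pow L. (- 1) ^ card (L - Z) * f (Z \<union> C))"
  using assms(1,3)
proof (induction C arbitrary: f)
  case empty
  then show ?case
    by (simp add: subset_moebius_def)
next
  case (insert c C)
  have step: "subset_moebius f (L \<union> D) + subset_moebius f (L \<union> insert c D)
      = subset_moebius (\<lambda>B. f (insert c B)) (L \<union> D)" if "D \<subseteq> C" for D
  proof -
    have "finite (L \<union> D)" "c \<notin> L \<union> D"
      using that insert assms(2) by (auto intro: finite_subset)
    from moebius_insert[OF this] show ?thesis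
      by simp
  qed
  have "(\<Sum>D\<in>Pow (insert c C). subset_moebius f (L \<union> D))
      = (\<Sum>D\<in>Pow C. subset_moebius f (L \<union> D) + subset_moebius f (L \<union> insert c D))"
    using insert.hyps by (simp add: sum_Pow_insert sum.distrib)
  also have "\<dots> = (\<Sum>D\<in>Pow C. subset_moebius (\<lambda>B. f (insert c B)) (L \<union> D))"
    using step by (intro sum.cong) auto
  also have "\<dots> = (\<Sum>Z\<in>Pow L. (- 1) ^ card (L - Z) * f (insert c (Z \<union> C)))"
    using insert by auto
  finally show ?case
    by simp
qed

section \<open>Interactions sum to zero over each of their coordinates\<close>

lemma finite_cells: "finite A \<Longrightarrow> finite (cells d A)"
  by (simp add: cells_def finite_PiE)

lemma card_cells: "finite A \<Longrightarrow> card (cells d A) = (\<Prod>v\<in>A. d v)"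
  by (simp add: cells_def card_PiE)

lemma fun_upd_in_cells:
  assumes "x \<in> cells d A" "v \<in> A" "k < d v"
  shows "x(v := k) \<in> cells d A"
  using assms by (auto simp: cells_def PiE_iff extensional_def)

lemma cells_extend:
  assumes "x \<in> cells d Z" "Z \<subseteq> N" "\<And>v. v \<in> N \<Longrightarrow> d v \<ge> 1"
  obtains y where "y \<in> cells d N" "restrict y Z = x"
proof
  let ?y = "restrict (\<lambda>v. if v \<in> Z then x v else 0) N"
  show "?y \<in> cells d N"
    using assms by (force simp: cells_def PiE_iff Suc_le_eq)
  show "restrict ?y Z = x"
    using assms by (intro ext) (auto simp: cells_def PiE_iff restrict_def extensional_def)
qed

lemma restrict_eq_restrict_iff: "restrict j A = restrict x A \<longleftrightarrow> (\<forall>a\<in>A. j a = x a)"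
  by (metis restrict_apply' restrict_ext)

text \<open>
  The cells that agree with \<open>x\<close> on \<open>B\<close> are partitioned according to their level at \<open>v\<close>. The
  factor \<open>d v\<close> arises because dropping \<open>v\<close> multiplies the number of cells averaged over by \<open>d v\<close>.
\<close>

lemma sum_levels_nu:
  assumes "finite N" "insert v B \<subseteq> N" "v \<notin> B" "d v \<ge> 1"
  shows "(\<Sum>k<d v. nu d p N (insert v B) (restrict (x(v := k)) (insert v B)))
       = real (d v) * nu d p N B (restrict x B)"
proof -
  let ?h = "\<lambda>j. ln (pmf (marginal p N) j)"
  let ?J = "\<lambda>k. {j \<in> cells d N. restrict j (insert v B) = restrict (x(v := k)) (insert v B)}"
  have agree: "restrict j (insert v B) = restrict (x(v := k)) (insert v B)
      \<longleftrightarrow> restrict j B = restrict x B \<and> j v = k" for j k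
    using assms(3) by (auto simp: restrict_eq_restrict_iff)
  have part: "{j \<in> cells d N. restrict j B = restrict x B} = (\<Union>k<d v. ?J k)"
    unfolding agree using assms(2) by (auto simp: cells_def PiE_iff)
  have "sum ?h {j \<in> cells d N. restrict j B = restrict x B} = (\<Sum>k<d v. sum ?h (?J k))"
    unfolding part using finite_cells[OF assms(1)]
    by (intro sum.UNION_disjoint) (auto simp: agree)
  moreover have "card (cells d (N - B)) = d v * card (cells d (N - insert v B))"
  proof -
    have "N - B = insert v (N - insert v B)"
      using assms(2,3) by auto
    then have "card (cells d (N - B)) = card (cells d (insert v (N - insert v B)))"
      by (rule arg_cong)
    also have "\<dots> = d v * card (cells d (N - insert v B))"
      using assms(1) by (simp add: card_cells del: insert_Diff_single)
    finally show ?thesis .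
  qed
  ultimately show ?thesis
    using assms(4) by (simp add: nu_def sum_distrib_left)
qed

lemma mll_eq_moebius:
  "mll d p N Z (restrict x Z) = subset_moebius (\<lambda>B. nu d p N B (restrict x B)) Z"
  unfolding mll_def subset_moebius_def by (intro sum.cong) (auto simp: Int_absorb1)

text \<open>
  Splitting the Moebius transform at \<open>v\<close> leaves differences of \<open>\<nu>\<close> with and without \<open>v\<close>, whose sums
  over the levels of \<open>v\<close> cancel.
\<close>

lemma sum_levels_mll:
  assumes "finite N" "Z \<subseteq> N" "v \<in> Z" "d v \<ge> 1"
  shows "(\<Sum>k<d v. mll d p N Z (restrict (x(v := k)) Z)) = 0"
proof -
  let ?A = "Z - {v}"
  let ?f = "\<lambda>y B. nu d p N B (restrict y B)"
  have A: "finite ?A" "v \<notin> ?A" "insert v ?A = Z"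
    using assms by (auto intro: finite_subset)
  have split: "mll d p N Z (restrict (x(v := k)) Z)
      = (\<Sum>B\<in>Pow ?A. (- 1) ^ card (?A - B) * (?f (x(v := k)) (insert v B) - ?f x B))" for k
  proof -
    have "mll d p N Z (restrict (x(v := k)) Z)
        = subset_moebius (\<lambda>B. ?f (x(v := k)) (insert v B)) ?A - subset_moebius (?f (x(v := k))) ?A"
      using moebius_insert[OF A(1,2), unfolded A(3)] by (simp add: mll_eq_moebius)
    moreover have "restrict (x(v := k)) B = restrict x B" if "B \<subseteq> ?A" for B
      using that by (auto simp: restrict_eq_restrict_iff)
    ultimately show ?thesis
      by (simp add: subset_moebius_def right_diff_distrib sum_subtractf)
  qed
  have "(\<Sum>k<d v. mll d p N Z (restrict (x(v := k)) Z))
      = (\<Sum>B\<in>Pow ?A. (- 1) ^ card (?A - B) * (\<Sum>k<d v. ?f (x(v := k)) (insert v B) - ?f x B))"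
    unfolding split sum_distrib_left by (rule sum.swap)
  also have "\<dots> = 0"
  proof (rule sum.neutral, rule ballI)
    fix B assume "B \<in> Pow ?A"
    then have "insert v B \<subseteq> N" "v \<notin> B"
      using assms(2,3) by auto
    from sum_levels_nu[OF assms(1) this, where d = d and x = x] assms(4)
    show "(- 1) ^ card (?A - B) * (\<Sum>k<d v. ?f (x(v := k)) (insert v B) - ?f x B) = 0"
      by (simp add: sum_subtractf)
  qed
  finally show ?thesis .
qed

section \<open>Independence of interactions\<close>

text \<open>
  Summing the identity \<open>\<Sum>\<^bsub>Z \<subseteq> S\<^esub> g Z = 0\<close> over the levels of some \<open>v \<in> S\<close> kills the terms with
  \<open>v \<in> Z\<close> and multiplies the others by \<open>d v \<noteq> 0\<close>, which leaves the same identity for \<open>S - {v}\<close>.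
  By induction \<open>g Z = 0\<close> for every proper subset \<open>Z\<close> of \<open>S\<close>, and then the identity itself says that
  \<open>g S = 0\<close>.
\<close>

lemma interactions_vanish:
  fixes g :: "'v set \<Rightarrow> ('v \<Rightarrow> nat) \<Rightarrow> real"
  assumes "finite S" "S \<subseteq> N"
    and pos: "\<And>v. v \<in> N \<Longrightarrow> d v \<ge> 1"
    and indep: "\<And>Z v x k. Z \<subseteq> N \<Longrightarrow> v \<notin> Z \<Longrightarrow> g Z (x(v := k)) = g Z x"
    and zero: "\<And>Z v x. Z \<subseteq> N \<Longrightarrow> v \<in> Z \<Longrightarrow> (\<Sum>k<d v. g Z (x(v := k))) = 0"
    and total: "\<And>x. x \<in> cells d N \<Longrightarrow> (\<Sum>Z\<in>Pow S. g Z x) = 0"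
    and "Z \<subseteq> S" "x \<in> cells d N"
  shows "g Z x = 0"
  using assms(1,2,6,7,8)
proof (induction S arbitrary: Z x rule: finite_psubset_induct)
  case (psubset S)
  have proper: "g Y y = 0" if "Y \<subset> S" "y \<in> cells d N" for Y y
  proof -
    obtain v where v: "v \<in> S" "v \<notin> Y"
      using \<open>Y \<subset> S\<close> by blast
    let ?R = "S - {v}"
    have S: "S = insert v ?R" and R: "finite ?R" "v \<notin> ?R"
      using v(1) psubset.hyps by auto
    have "(\<Sum>W\<in>Pow ?R. g W z) = 0" if z: "z \<in> cells d N" for z
    proof -
      have "v \<in> N"
        using psubset.prems(1) v(1) by auto
      then have "0 = (\<Sum>k<d v. \<Sum>W\<in>Pow S. g W (z(v := k)))"
        by (intro sum.neutral[symmetric] ballI psubset.prems(2) fun_upd_in_cells z) auto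
      also have "\<dots> = (\<Sum>W\<in>Pow S. \<Sum>k<d v. g W (z(v := k)))"
        by (rule sum.swap)
      also have "\<dots> = (\<Sum>W\<in>Pow ?R. \<Sum>k<d v. g W (z(v := k)))
          + (\<Sum>W\<in>Pow ?R. \<Sum>k<d v. g (insert v W) (z(v := k)))"
        by (subst S) (rule sum_Pow_insert[OF R])
      also have "(\<Sum>W\<in>Pow ?R. \<Sum>k<d v. g W (z(v := k))) = (\<Sum>W\<in>Pow ?R. real (d v) * g W z)"
      proof (intro sum.cong refl)
        fix W assume "W \<in> Pow ?R"
        then have "W \<subseteq> N" "v \<notin> W"
          using psubset.prems(1) by auto
        then show "(\<Sum>k<d v. g W (z(v := k))) = real (d v) * g W z"
          by (simp add: indep)
      qed
      also have "(\<Sum>W\<in>Pow ?R. \<Sum>k<d v. g (insert v W) (z(v := k))) = 0"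
        using psubset.prems(1) v(1) by (intro sum.neutral ballI zero) auto
      finally have "real (d v) * (\<Sum>W\<in>Pow ?R. g W z) = 0"
        by (simp add: sum_distrib_left)
      moreover have "d v \<ge> 1"
        using pos psubset.prems(1) v(1) by auto
      ultimately show ?thesis
        by simp
    qed
    moreover have "?R \<subset> S" "?R \<subseteq> N" "Y \<subseteq> ?R"
      using v that(1) psubset.prems(1) by auto
    ultimately show ?thesis
      using psubset.IH that(2) by blast
  qed
  have "(\<Sum>W\<in>Pow S. g W x) = g S x + (\<Sum>W\<in>Pow S - {S}. g W x)"
    using psubset.hyps by (intro sum.remove) auto
  moreover have "(\<Sum>W\<in>Pow S - {S}. g W x) = 0"
    using proper psubset.prems(4) by (intro sum.neutral) auto
  ultimately have "g S x = 0"
    using psubset.prems(2,4) by simp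
  then show ?case
    using proper psubset.prems(3,4) by blast
qed

section \<open>Strict collapsibility\<close>

theorem theorem3p3:
  fixes V L M N :: "'v set"
    and d :: "'v \<Rightarrow> nat"
    and p :: "('v \<Rightarrow> nat) pmf"
  assumes "finite V"
    and "\<And>v. v \<in> V \<Longrightarrow> d v \<ge> 1"
    and "set_pmf p = cells d V"
    and "L \<noteq> {}" and "L \<subseteq> M" and "M \<subset> N" and "N \<subseteq> V"
    and "collapsible d p N M L"
  shows "strictly_collapsible d p N M L \<longleftrightarrow>
    (\<forall>x\<in>cells d N.
       (\<Sum>Z\<in>Pow L. (- 1) ^ card (L - Z) * nu d p N (Z \<union> (N - L)) (restrict x (Z \<union> (N - L)))) =
       (\<Sum>Z\<in>Pow L. (- 1) ^ card (L - Z) * nu d p N (Z \<union> (M - L)) (restrict x (Z \<union> (M - L)))))"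
proof -
  have LN: "L \<subseteq> N"
    using assms(5,6) by auto
  then have fin: "finite N" "finite L"
    using assms(1,7) by (meson finite_subset)+
  have pos: "\<And>v. v \<in> N \<Longrightarrow> d v \<ge> 1"
    using assms(2,7) by auto
  define I where "I = {Z. L \<subset> Z \<and> Z \<subseteq> N \<and> \<not> Z \<subseteq> M}"
  define g where "g Z x = (if Z \<in> I then mll d p N Z (restrict x Z) else 0)" for Z x
  let ?alt = "\<lambda>K x. \<Sum>Z\<in>Pow L. (- 1) ^ card (L - Z)
    * nu d p N (Z \<union> (K - L)) (restrict x (Z \<union> (K - L)))"
  have alt: "?alt K x = (\<Sum>D\<in>Pow (K - L). mll d p N (L \<union> D) (restrict x (L \<union> D)))"
    if "K \<subseteq> N" for K x
    using sum_moebius_disjoint_union[of "K - L" L "\<lambda>B. nu d p N B (restrict x B)"]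
      that fin finite_subset[OF that] by (simp add: mll_eq_moebius)
  have diff: "?alt N x - ?alt M x = (\<Sum>Z\<in>Pow N. g Z x)" for x
  proof -
    let ?F = "\<lambda>Z. mll d p N Z (restrict x Z)"
    have "?alt N x - ?alt M x = (\<Sum>D\<in>Pow (N - L) - Pow (M - L). ?F (L \<union> D))"
    proof -
      have "M \<subseteq> N" "Pow (M - L) \<subseteq> Pow (N - L)"
        using assms(6) by auto
      then show ?thesis
        using fin by (simp add: alt sum_diff)
    qed
    also have "\<dots> = sum ?F I"
      by (rule sum.reindex_bij_witness[of _ "\<lambda>Z. Z - L" "\<lambda>D. L \<union> D"])
        (use LN assms(5) in \<open>auto simp: I_def\<close>)
    also have "\<dots> = (\<Sum>Z\<in>Pow N. g Z x)"
      using fin by (intro sum.mono_neutral_cong_left) (auto simp: I_def g_def)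
    finally show ?thesis .
  qed
  have strict: "strictly_collapsible d p N M L
      \<longleftrightarrow> (\<forall>Z\<in>I. \<forall>x\<in>cells d Z. mll d p N Z x = 0)"
    using assms(8) by (auto simp: strictly_collapsible_def I_def)
  also have "\<dots> \<longleftrightarrow> (\<forall>x\<in>cells d N. (\<Sum>Z\<in>Pow N. g Z x) = 0)"
  proof
    assume *: "\<forall>Z\<in>I. \<forall>x\<in>cells d Z. mll d p N Z x = 0"
    have "restrict x Z \<in> cells d Z" if "Z \<in> I" "x \<in> cells d N" for x Z
      using that by (auto simp: cells_def I_def PiE_iff)
    then show "\<forall>x\<in>cells d N. (\<Sum>Z\<in>Pow N. g Z x) = 0"
      using * by (auto simp: g_def intro!: sum.neutral)
  next
    assume total: "\<forall>x\<in>cells d N. (\<Sum>Z\<in>Pow N. g Z x) = 0"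
    show "\<forall>Z\<in>I. \<forall>x\<in>cells d Z. mll d p N Z x = 0"
    proof (intro ballI)
      fix Z x assume Z: "Z \<in> I" and x: "x \<in> cells d Z"
      then have ZN: "Z \<subseteq> N"
        by (simp add: I_def)
      obtain y where y: "y \<in> cells d N" "restrict y Z = x"
        using cells_extend[OF x ZN pos] by blast
      have "g Z y = 0"
      proof (rule interactions_vanish[of N N d g, OF fin(1) subset_refl pos])
        show "g W (z(v := k)) = g W z" if "v \<notin> W" for W v z k
        proof -
          have "restrict (z(v := k)) W = restrict z W"
            using that by (auto simp: restrict_eq_restrict_iff)
          then show ?thesis
            by (simp add: g_def)
        qed
        show "(\<Sum>k<d v. g W (z(v := k))) = 0" if "W \<subseteq> N" "v \<in> W" for W v z
        proof -
          have "d v \<ge> 1"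
            using pos that by auto
          from sum_levels_mll[where d = d, OF fin(1) that this] show ?thesis
            by (cases "W \<in> I") (simp_all add: g_def)
        qed
      qed (use total ZN y in auto)
      then show "mll d p N Z x = 0"
        using Z y by (simp add: g_def)
    qed
  qed
  also have "\<dots> \<longleftrightarrow> (\<forall>x\<in>cells d N. ?alt N x = ?alt M x)"
    by (simp flip: diff)
  finally show ?thesis .
qed

end
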